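(* Let $f\in\mathcal{A}$ and let $$\mathcal{G}(z)=1-\frac{zf'(z)}{f(z)}+\frac{zf''(z)}{f'(z)},\quad z\in\mathbb{D}.$$ If $f$ satisfies the subordination $$\left(1+\beta\,\mathcal{G}(z)\right)\frac{zf'(z)}{f(z)}\prec e^z,$$ then $f\in\mathcal{S}^*_{Ne}$ for $\beta\ge\beta_e\approx1.14016$, where $\beta_e$ is the unique solution in $(0,\infty)$ of $$\sum_{j=0}^\infty\frac{1}{j!\,(1+j\beta)}-\frac53=0.$$
   Context: $\mathbb{D}=\{z\in\mathbb{C}:|z|<1\}$. $\mathcal{A}$ is the class of analytic functions $f$ on $\mathbb{D}$ with $f(0)=0$ and $f'(0)=1$. For $f$ analytic on $\mathbb{D}$ and $g$ univalent (analytic and injective) on $\mathbb{D}$, $f\prec g$ means $f(0)=g(0)$ and $f(\mathbb{D})\subset g(\mathbb{D})$. $\mathcal{S}^*_{Ne}$ is the class of all $f\in\mathcal{A}$ with $\frac{zf'(z)}{f(z)}\prec\varphi_{Ne}(z)$, where $\varphi_{Ne}(z)=1+z-z^3/3$ (univalent on $\mathbb{D}$). The function on the left of a subordination is understood to be analytic on $\mathbb{D}$ (removable singularities being filled in; e.g. $zf'(z)/f(z)$ takes the value $1$ at $z=0$).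
   Formalization: The printed value 1.14016 for β_e is inaccurate (the root of the equation is about 1.13915); the formal statement defines β_e exactly by its equation and asserts only that it lies within 0.002 of 1.14016. *)

theory Defs
  imports "HOL-Complex_Analysis.Complex_Analysis"
begin

abbreviation unit_disc :: "complex set" where
  "unit_disc \<equiv> ball 0 1"

definition class_A :: "(complex \<Rightarrow> complex) set" where
  "class_A = {f. f holomorphic_on unit_disc \<and> f 0 = 0 \<and> deriv f 0 = 1}"

definition univalent :: "(complex \<Rightarrow> complex) \<Rightarrow> bool" where
  "univalent g \<longleftrightarrow> g holomorphic_on unit_disc \<and> inj_on g unit_disc"

(* The standing requirements (left side analytic, right side univalent) are part of the
   relation, so that it never holds between functions for which it is not meant. *)
definition subordinate :: "(complex \<Rightarrow> complex) \<Rightarrow> (complex \<Rightarrow> complex) \<Rightarrow> bool"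
    (infix "\<prec>\<^sub>s" 50) where
  "f \<prec>\<^sub>s g \<longleftrightarrow>
     f holomorphic_on unit_disc \<and> univalent g \<and>
     f 0 = g 0 \<and> f ` unit_disc \<subseteq> g ` unit_disc"

(* The quotients below are total functions with x / 0 = 0. Wherever they are compared by
   subordination, remove_sings replaces the value at every point by the limit there, so the
   values at zeros of f and f' are irrelevant. At a pole remove_sings takes the value 0, but
   then the resulting function is not continuous, so a subordination still forces every
   singularity in the disc to be removable. *)
definition log_quot :: "(complex \<Rightarrow> complex) \<Rightarrow> complex \<Rightarrow> complex" where
  "log_quot f z = z * deriv f z / f z"

definition calG :: "(complex \<Rightarrow> complex) \<Rightarrow> complex \<Rightarrow> complex" where
  "calG f z = 1 - z * deriv f z / f z + z * deriv (deriv f) z / deriv f z"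

definition phi_Ne :: "complex \<Rightarrow> complex" where
  "phi_Ne z = 1 + z - z ^ 3 / 3"

definition S_star_Ne :: "(complex \<Rightarrow> complex) set" where
  "S_star_Ne = {f \<in> class_A. remove_sings (log_quot f) \<prec>\<^sub>s phi_Ne}"

end

theory Submission
  imports Defs
begin

text \<open>
Write \<open>P(z) = z f'(z) / f(z)\<close>. Logarithmic differentiation gives \<open>z P' = P \<G>\<close>, where \<open>\<G>\<close> is
\<^const>\<open>calG\<close>, so the function subordinate to the exponential is
\<open>h = (1 + b \<G>) P = P + b z P'\<close>: the hypothesis is a linear differential equation for \<open>P\<close>.

Integrating it along a radius amounts to averaging \<open>h\<close>, since the derivative of
\<open>t powr (1/b) * (P(t z) - 1)\<close> is \<open>(1/b) t powr (1/b - 1) * (h(t z) - 1)\<close>. The Schwarz lemma applied to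
\<open>Ln h\<close> bounds \<open>\<bar>h(z) - 1\<bar>\<close> by \<open>exp \<bar>z\<bar> - 1\<close> (\<open>subordinate_exp_bound\<close>). The same averaging
applied to \<open>exp\<close> produces the series \<open>q(x) = \<Sum>j. x\<^sup>j / (j! (1 + j b))\<close>, the solution of
\<open>q + b x q' = exp\<close>, and therefore \<open>\<bar>P(z) - 1\<bar> \<le> q(\<bar>z\<bar>) - 1\<close>
(\<open>norm_minus_1_le_q_series\<close>). As \<open>q\<close> is convex on the positive half-line, the right-hand side is
at most \<open>\<bar>z\<bar> (q(1) - 1)\<close>. The condition \<open>b \<ge> \<beta>\<^sub>e\<close> says exactly that \<open>q(1) - 1 \<le> 2/3\<close>, because \<open>q(1)\<close> decreases in \<open>b\<close>. Finally,
the disc of radius \<open>2/3\<close> about 1 lies inside the nephroid region bounded by the image of the unit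
circle under \<^const>\<open>phi_Ne\<close> (\<open>ball_subset_phi_Ne_image\<close>); it touches the nephroid at its cusps
\<open>1/3\<close> and \<open>5/3\<close>, which is where the constant \<open>5/3\<close> comes from.

A function in the class may have zeros other than the origin, and there \<open>P\<close> has a pole. Such zeros
are ruled out by the hypothesis (\<open>class_A_nonzero\<close>): at a simple pole of \<open>P\<close>, the combination
\<open>P + b z P'\<close> has a double pole, whereas \<open>h\<close> is analytic.
\<close>

section \<open>The averaged exponential series\<close>

definition coeff_q :: "real \<Rightarrow> nat \<Rightarrow> real" where
  "coeff_q b j = 1 / (fact j * (1 + real j * b))"

text \<open>For \<open>b > 0\<close> this is the mean \<open>(1/b) \<integral>\<^sub>0\<^sup>1 t powr (1/b - 1) exp(t x) dt\<close> of the exponential, integrated term by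
term. At \<open>b = 0\<close> the series is the exponential itself.\<close>

definition q_series :: "real \<Rightarrow> real \<Rightarrow> real" where
  "q_series b x = (\<Sum>j. coeff_q b j * x ^ j)"

lemma coeff_q_nonneg: "b \<ge> 0 \<Longrightarrow> coeff_q b j \<ge> 0"
  by (simp add: coeff_q_def)

lemma coeff_q_0 [simp]: "coeff_q b 0 = 1"
  by (simp add: coeff_q_def)

lemma coeff_q_antimono:
  assumes "0 \<le> a" "a \<le> b"
  shows "coeff_q b j \<le> coeff_q a j"
  unfolding coeff_q_def using assms
  by (intro divide_left_mono mult_left_mono add_left_mono mult_pos_pos) (auto simp: add_pos_nonneg)

lemma coeff_q_le_inverse_fact:
  assumes "b \<ge> 0"
  shows "coeff_q b j \<le> inverse (fact j)"
  using coeff_q_antimono[OF order_refl assms, of j] by (simp add: coeff_q_def inverse_eq_divide)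

lemma summable_coeff_q:
  assumes "b \<ge> 0"
  shows "summable (\<lambda>j. coeff_q b j * x ^ j)"
proof (rule summable_comparison_test')
  show "summable (\<lambda>j. inverse (fact j) * \<bar>x\<bar> ^ j)"
    by (rule summable_exp)
  show "norm (coeff_q b j * x ^ j) \<le> inverse (fact j) * \<bar>x\<bar> ^ j" for j
    using coeff_q_le_inverse_fact[OF assms, of j] coeff_q_nonneg[OF assms, of j]
    by (simp add: abs_mult power_abs mult_right_mono)
qed

lemma q_series_0 [simp]: "q_series b 0 = 1"
  unfolding q_series_def by (subst powser_zero) simp

lemma q_series_1: "q_series b 1 = (\<Sum>j. 1 / (fact j * (1 + real j * b)))"
  by (simp add: q_series_def coeff_q_def)

text \<open>The operator \<open>q \<mapsto> q + b x q'\<close> multiplies the \<open>j\<close>-th coefficient by \<open>1 + j b\<close>, which turns the series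
into the exponential series.\<close>

lemma q_series_ODE:
  assumes b: "b \<ge> 0"
  obtains d where "(q_series b has_real_derivative d) (at x)"
    and "q_series b x + b * (x * d) = exp x"
proof
  let ?d = "\<Sum>n. diffs (coeff_q b) n * x ^ n"
  show "(q_series b has_real_derivative ?d) (at x)"
    unfolding q_series_def
    by (rule termdiffs_strong_converges_everywhere) (rule summable_coeff_q[OF b])
  have "summable (\<lambda>n. diffs (coeff_q b) n * x ^ n)"
    by (rule termdiff_converges_all) (rule summable_coeff_q[OF b])
  from sums_mult[OF diffs_equiv[OF this], of x]
  have "(\<lambda>n. real n * coeff_q b n * x ^ n) sums (x * ?d)"
    by (rule sums_cong[THEN iffD1, rotated]) (auto simp: power_eq_if)
  then have "(\<lambda>n. coeff_q b n * x ^ n + b * (real n * coeff_q b n * x ^ n))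
      sums (q_series b x + b * (x * ?d))"
    unfolding q_series_def
    by (intro sums_add sums_mult summable_sums summable_coeff_q[OF b])
  moreover have "coeff_q b n * x ^ n + b * (real n * coeff_q b n * x ^ n) = x ^ n /\<^sub>R fact n" for n
  proof -
    have "1 + real n * b \<noteq> 0"
      using b by (smt (verit) mult_nonneg_nonneg of_nat_0_le_iff)
    then have "(1 + real n * b) * coeff_q b n = inverse (fact n)"
      unfolding coeff_q_def inverse_eq_divide by (subst times_divide_eq_right, subst mult_1_right, rule nonzero_divide_mult_cancel_right)
    then have "(1 + real n * b) * coeff_q b n * x ^ n = inverse (fact n) * x ^ n"
      by simp
    then show ?thesis
      by (simp add: algebra_simps)
  qed
  ultimately show "q_series b x + b * (x * ?d) = exp x"
    using exp_converges[of x] sums_unique2 by force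
qed

text \<open>All coefficients are nonnegative and \<open>x\<^sup>j \<le> x\<close> for \<open>j \<ge> 1\<close>. The factor \<open>x\<close> on the right supplies the
strict inequality inside the disc when the value at 1 is exactly the critical one.\<close>

lemma q_series_le_chord:
  assumes b: "b \<ge> 0" and x: "0 \<le> x" "x \<le> 1"
  shows "q_series b x - 1 \<le> x * (q_series b 1 - 1)"
proof -
  have tail: "q_series b y - 1 = (\<Sum>n. coeff_q b (Suc n) * y ^ Suc n)" for y
    using suminf_split_head[OF summable_coeff_q[OF b, of y]] by (simp add: q_series_def)
  have sm: "summable (\<lambda>n. coeff_q b (Suc n) * y ^ Suc n)" for y
    using summable_Suc_iff[THEN iffD2, OF summable_coeff_q[OF b, of y]] by simp
  have "q_series b x - 1 \<le> (\<Sum>n. x * (coeff_q b (Suc n) * 1 ^ Suc n))"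
    unfolding tail
  proof (rule suminf_le[OF _ sm summable_mult[OF sm]])
    show "coeff_q b (Suc n) * x ^ Suc n \<le> x * (coeff_q b (Suc n) * 1 ^ Suc n)" for n
      using mult_left_mono[OF power_decreasing[of 1 "Suc n" x] coeff_q_nonneg[OF b, of "Suc n"]] x
      by (simp add: mult.commute)
  qed
  also have "\<dots> = x * (q_series b 1 - 1)"
    unfolding tail by (rule suminf_mult[OF sm])
  finally show ?thesis .
qed

section \<open>The critical parameter\<close>

lemma q_series_1_strict_antimono:
  assumes "0 \<le> a" "a < b"
  shows "q_series b 1 < q_series a 1"
proof -
  have sm: "summable (\<lambda>j. coeff_q a j - coeff_q b j)"
    using summable_diff[OF summable_coeff_q[of a 1] summable_coeff_q[of b 1]] assms by simp
  have "coeff_q b 1 < coeff_q a 1"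
    using assms by (simp add: coeff_q_def field_simps)
  then have "0 < (\<Sum>j. coeff_q a j - coeff_q b j)"
    using coeff_q_antimono assms
    by (intro suminf_pos2[OF sm, of 1]) auto
  also have "\<dots> = q_series a 1 - q_series b 1"
    using suminf_diff[OF summable_coeff_q[of a 1] summable_coeff_q[of b 1]] assms
    by (simp add: q_series_def)
  finally show ?thesis
    by simp
qed

lemma continuous_on_q_series_1: "continuous_on {0..} (\<lambda>b. q_series b 1)"
proof (rule uniform_limit_theorem)
  show "uniform_limit {0..} (\<lambda>n b. \<Sum>j<n. coeff_q b j) (\<lambda>b. q_series b 1) sequentially"
    unfolding q_series_def power_one mult_1_right
  proof (rule Weierstrass_m_test)
    show "summable (\<lambda>j. inverse (fact j) :: real)"
      using summable_exp[of "1::real"] by simp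
    show "norm (coeff_q b j) \<le> inverse (fact j)" if "b \<in> {0..}" for j b
      using that coeff_q_le_inverse_fact[of b j] coeff_q_nonneg[of b j] by simp
  qed
  have "fact j * (1 + real j * b) \<noteq> 0" if "b \<ge> 0" for j b
    using that by (smt (verit) fact_nonzero mult_eq_0_iff mult_nonneg_nonneg of_nat_0_le_iff)
  then have "continuous_on {0..} (\<lambda>b. coeff_q b j)" for j
    unfolding coeff_q_def by (intro continuous_intros) (metis atLeast_iff)
  then show "\<forall>\<^sub>F n in sequentially. continuous_on {0..} (\<lambda>b. \<Sum>j<n. coeff_q b j)"
    by (intro always_eventually allI continuous_on_sum)
qed simp

text \<open>The root is close to \<open>1.13915\<close>. It is bracketed by \<open>1.1385\<close> and \<open>1.142\<close>, which both lie within
\<open>0.002\<close> of \<open>1.14016\<close>. At the left end, the first eight terms already exceed \<open>5/3\<close>.\<close>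

lemma q_series_1_lower: "5 / 3 \<le> q_series (1.1385) 1"
proof -
  have "5 / 3 \<le> (\<Sum>j<8. coeff_q 1.1385 j)"
    by (simp add: coeff_q_def eval_nat_numeral)
  also have "\<dots> \<le> q_series (1.1385) 1"
    unfolding q_series_def power_one mult_1_right
  proof (rule sum_le_suminf)
    show "summable (coeff_q 1.1385)"
      using summable_coeff_q[of "1.1385" 1] by simp
    show "0 \<le> coeff_q 1.1385 n" for n
      by (rule coeff_q_nonneg) simp
  qed simp
  finally show ?thesis .
qed

text \<open>This compares the tail of the series from \<open>j = k\<close> on with the tail of the series for \<open>e\<close>.\<close>

lemma coeff_q_le_quotient:
  assumes "b \<ge> 0" "k \<le> j"
  shows "coeff_q b j \<le> 1 / (1 + real k * b) * inverse (fact j)"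
proof -
  have "1 / (1 + real j * b) \<le> 1 / (1 + real k * b)"
    using assms
    by (intro divide_left_mono mult_pos_pos add_left_mono mult_right_mono) (auto simp: add_pos_nonneg)
  from mult_right_mono[OF this, of "inverse (fact j)"] show ?thesis
    by (simp add: coeff_q_def divide_inverse mult.commute)
qed

text \<open>The first six terms are kept, and the tail is at most the tail \<open>e - \<Sum>j<6. 1/j!\<close> divided by
\<open>1 + 6 b\<close>; the estimate \<open>e < 2.72\<close> is accurate enough.\<close>

lemma q_series_1_upper: "q_series (1.142) 1 \<le> 5 / 3"
proof -
  let ?b = "1.142 :: real"
  let ?c = "1 / (1 + 6 * ?b)"
  define rest where "rest = (\<Sum>j. coeff_q ?b (j + 6))"
  define erest where "erest = (\<Sum>j. inverse (fact (j + 6)) :: real)"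
  have sm: "summable (coeff_q ?b)" "summable (\<lambda>j. inverse (fact j) :: real)"
    using summable_coeff_q[of ?b 1] summable_exp[of "1::real"] by simp_all
  have q: "q_series ?b 1 = rest + (\<Sum>j<6. coeff_q ?b j)"
    unfolding q_series_def power_one mult_1_right rest_def
    by (rule suminf_split_initial_segment[OF sm(1)])
  have e: "exp 1 = erest + (\<Sum>j<6. inverse (fact j))"
    using suminf_split_initial_segment[OF sm(2), of 6] exp_converges[of "1::real"]
    by (simp add: sums_iff erest_def)
  have "rest \<le> (\<Sum>j. ?c * inverse (fact (j + 6)))"
    unfolding rest_def
  proof (rule suminf_le)
    show "coeff_q ?b (j + 6) \<le> ?c * inverse (fact (j + 6))" for j
      using coeff_q_le_quotient[of ?b 6 "j + 6"] by simp
    show "summable (\<lambda>j. coeff_q ?b (j + 6))"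
      using sm(1) by (rule summable_ignore_initial_segment)
    show "summable (\<lambda>j. ?c * inverse (fact (j + 6)))"
      by (intro summable_mult summable_ignore_initial_segment sm(2))
  qed
  also have "\<dots> = ?c * erest"
    unfolding erest_def by (intro suminf_mult summable_ignore_initial_segment sm(2))
  also have "?c * erest \<le> ?c * (2.72 - (\<Sum>j<6. inverse (fact j)))"
    using e e_less_272 by (intro mult_left_mono) simp_all
  finally have "rest + (\<Sum>j<6. coeff_q ?b j)
      \<le> ?c * (2.72 - (\<Sum>j<6. inverse (fact j))) + (\<Sum>j<6. coeff_q ?b j)"
    by (rule add_right_mono)
  also have "\<dots> \<le> 5 / 3"
    by (simp add: coeff_q_def lessThan_nat_numeral lessThan_Suc fact_numeral)
  finally show ?thesis
    unfolding q .
qed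

lemma q_series_1_eq_five_thirds:
  obtains b where "b > 0" "\<bar>b - 1.14016\<bar> < 0.002" "q_series b 1 = 5 / 3"
proof -
  have "\<exists>b\<ge>1.1385. b \<le> 1.142 \<and> q_series b 1 = 5 / 3"
    by (rule IVT2'[where f = "\<lambda>b. q_series b 1", OF q_series_1_upper q_series_1_lower])
      (auto intro: continuous_on_subset[OF continuous_on_q_series_1])
  then obtain b where b: "1.1385 \<le> b" "b \<le> 1.142" "q_series b 1 = 5 / 3"
    by blast
  have "b > 0"
    using b(1) by simp
  moreover have "b - 1.14016 < 0.002" "- (b - 1.14016) < 0.002"
    using b(1,2) by simp_all
  then have "\<bar>b - 1.14016\<bar> < 0.002"
    by (simp only: abs_less_iff)
  ultimately show ?thesis
    using b(3) by (rule that)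
qed

section \<open>Subordination to the exponential\<close>

text \<open>The series of \<open>exp z - 1\<close> has nonnegative coefficients.\<close>

lemma norm_exp_minus_1_le: "norm (exp z - 1) \<le> exp (norm z) - 1" for z :: complex
proof -
  have tail: "exp w - 1 = (\<Sum>n. w ^ Suc n /\<^sub>R fact (Suc n))"
    for w :: "'a :: {real_normed_field,banach}"
    using suminf_split_head[OF summable_exp_generic[of w]] by (simp add: exp_def del: fact_Suc power_Suc)
  have sm: "summable (\<lambda>n. norm z ^ Suc n /\<^sub>R fact (Suc n))"
    using summable_Suc_iff[THEN iffD2, OF summable_exp_generic[of "norm z"]] .
  have "norm (\<Sum>n. z ^ Suc n /\<^sub>R fact (Suc n)) \<le> (\<Sum>n. norm z ^ Suc n /\<^sub>R fact (Suc n))"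
    by (rule norm_suminf_le[OF _ sm]) (simp add: norm_mult norm_power del: fact_Suc power_Suc)
  then show ?thesis
    by (simp only: tail)
qed

text \<open>On the unit disc the imaginary part is less than 1 in modulus, so the exponential maps the disc
into the right half-plane and the principal logarithm inverts it there. Hence \<open>Ln \<circ> h\<close> is an
analytic self-map of the disc fixing 0, and the Schwarz lemma applies.\<close>

lemma subordinate_exp_bound:
  assumes h: "h \<prec>\<^sub>s exp" and z: "z \<in> unit_disc"
  shows "norm (h z - 1) \<le> exp (norm z) - 1"
proof -
  have hol: "h holomorphic_on unit_disc" and h0: "h 0 = 1" and sub: "h ` unit_disc \<subseteq> exp ` unit_disc"
    using h by (auto simp: subordinate_def)
  have log: "norm (Ln (h w)) < 1 \<and> exp (Ln (h w)) = h w \<and> h w \<notin> \<real>\<^sub>\<le>\<^sub>0" if "w \<in> unit_disc" for w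
  proof -
    have "h w \<in> exp ` unit_disc"
      using sub that by blast
    then obtain u where u: "norm u < 1" "h w = exp u"
      by auto
    have "\<bar>Im u\<bar> < 1"
      using abs_Im_le_cmod[of u] u by linarith
    then have Im: "-(pi/2) < Im u" "Im u < pi/2"
      using pi_gt3 by auto
    then have "Re (exp u) > 0"
      by (simp add: Re_exp cos_gt_zero_pi)
    moreover have "Ln (exp u) = u"
      using Im by (intro Ln_exp) auto
    ultimately show ?thesis
      using u by (auto simp: complex_nonpos_Reals_iff)
  qed
  have "norm (Ln (h z)) \<le> norm z"
  proof (rule Schwarz_Lemma(1))
    show "(\<lambda>w. Ln (h w)) holomorphic_on ball 0 1"
      using log hol by (intro holomorphic_intros) auto
  qed (use log h0 z in auto)
  then have "exp (norm (Ln (h z))) - 1 \<le> exp (norm z) - 1"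
    by simp
  moreover have "norm (h z - 1) \<le> exp (norm (Ln (h z))) - 1"
    using norm_exp_minus_1_le[of "Ln (h z)"] log[OF z] by simp
  ultimately show ?thesis
    by linarith
qed

section \<open>Radial comparison for the linear equation\<close>

text \<open>Along the radius through \<open>z\<close>, \<open>P - 1\<close> and \<open>q - 1\<close> satisfy the same first-order equation with
right-hand sides of which the second dominates the first. With the integrating factor \<open>t powr (1/b)\<close> the
comparison becomes one of derivatives. The factor vanishes at \<open>t = 0\<close>, so there is no
contribution from the initial value.\<close>

lemma norm_minus_1_le_q_series:
  assumes P: "P holomorphic_on unit_disc" and b: "b > 0"
    and bound: "\<And>w. w \<in> unit_disc \<Longrightarrow>
        norm (P w + of_real b * w * deriv P w - 1) \<le> exp (norm w) - 1"
    and z: "z \<in> unit_disc"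
  shows "norm (P z - 1) \<le> q_series b (norm z) - 1"
proof -
  let ?r = "norm z"
  define s where "s t = t powr (1 / b)" for t :: real
  define s' where "s' t = 1 / b * t powr (1 / b - 1)" for t :: real
  define u where "u t = of_real (s t) * (P (of_real t * z) - 1)" for t :: real
  define v where "v t = s t * (q_series b (t * ?r) - 1)" for t :: real
  have in_disc: "of_real t * z \<in> unit_disc" if "0 \<le> t" "t \<le> 1" for t
    using that z mult_left_le_one_le[of "norm z" t] by (simp add: norm_mult)
  have s_cont: "continuous_on {0..1} s"
    unfolding s_def using b by (intro continuous_on_powr' continuous_intros) auto
  have s_deriv: "(s has_real_derivative s' t) (at t)" if "t > 0" for t
    unfolding s_def s'_def using that by (rule has_real_derivative_powr)
  have s_eq: "s t = b * t * s' t" if "t > 0" for t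
    using that b by (simp add: s_def s'_def powr_diff)
  \<comment> \<open>At 0 the factor \<open>s\<close> may fail to be differentiable; continuity there is enough for this bound.\<close>
  have "norm (u 1 - u 0) \<le> v 1 - v 0"
  proof (rule differentiable_bound_general[where f' = "\<lambda>t. of_real (s' t) *
        (P (of_real t * z) + of_real b * (of_real t * z) * deriv P (of_real t * z) - 1)"
        and \<phi>' = "\<lambda>t. s' t * (exp (t * ?r) - 1)"])
    show "continuous_on {0..1} u"
      unfolding u_def
      by (intro continuous_on_mult continuous_on_of_real s_cont continuous_on_diff
          continuous_on_const continuous_on_id
          continuous_on_compose2[OF holomorphic_on_imp_continuous_on[OF P]])
        (use in_disc in auto)
    have "isCont (q_series b) x" for x
      by (rule q_series_ODE[of b x]) (use b in \<open>auto dest: DERIV_isCont\<close>)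
    then have "continuous_on UNIV (q_series b)"
      by (simp add: continuous_at_imp_continuous_on)
    then have "continuous_on {0..1} (\<lambda>t. q_series b (t * ?r))"
      by (rule continuous_on_compose2) (auto intro!: continuous_intros)
    then show "continuous_on {0..1} v"
      unfolding v_def by (intro continuous_on_mult s_cont continuous_on_diff continuous_on_const)
  next
    fix t :: real assume t: "0 < t" "t < 1"
    let ?w = "of_real t * z"
    have "(P has_field_derivative deriv P ?w) (at ?w)"
      using P in_disc[of t] t by (intro holomorphic_derivI[of _ unit_disc]) auto
    moreover have "((\<lambda>t. of_real t * z) has_vector_derivative z) (at t)"
      by (auto intro!: derivative_eq_intros)
    ultimately have "(P \<circ> (\<lambda>t. of_real t * z) has_vector_derivative z * deriv P ?w) (at t)"
      by (rule field_vector_diff_chain_at[rotated])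
    then have "((\<lambda>t. P (of_real t * z) - 1) has_vector_derivative z * deriv P ?w) (at t)"
      by (auto simp: o_def intro!: derivative_eq_intros)
    moreover have "((\<lambda>t. of_real (s t) :: complex) has_vector_derivative of_real (s' t)) (at t)"
      using s_deriv[OF t(1)]
      by (intro has_vector_derivative_of_real) (simp add: has_real_derivative_iff_has_vector_derivative)
    ultimately have "(u has_vector_derivative
        (of_real (s t) * (z * deriv P ?w) + of_real (s' t) * (P ?w - 1))) (at t)"
      unfolding u_def by (rule has_vector_derivative_mult[rotated])
    then show "(u has_vector_derivative
        of_real (s' t) * (P ?w + of_real b * ?w * deriv P ?w - 1)) (at t)"
      by (simp add: s_eq[OF t(1)] algebra_simps)
    obtain d where d: "(q_series b has_real_derivative d) (at (t * ?r))"
      and ode: "q_series b (t * ?r) + b * (t * ?r * d) = exp (t * ?r)"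
      using q_series_ODE[of b "t * ?r"] b by auto
    have "((\<lambda>t. q_series b (t * ?r) - 1) has_real_derivative (d * ?r)) (at t)"
      by (auto intro!: derivative_eq_intros DERIV_chain2[where f = "q_series b" and g = "\<lambda>t. t * ?r" and x = t, OF d])
    from DERIV_mult[OF s_deriv[OF t(1)] this]
    have "(v has_real_derivative s' t * (q_series b (t * ?r) - 1) + d * ?r * s t) (at t)"
      unfolding v_def .
    also have "s' t * (q_series b (t * ?r) - 1) + d * ?r * s t = s' t * (exp (t * ?r) - 1)"
      unfolding ode[symmetric] s_eq[OF t(1)] by (simp add: algebra_simps)
    finally show "(v has_vector_derivative s' t * (exp (t * ?r) - 1)) (at t)"
      by (simp add: has_real_derivative_iff_has_vector_derivative)
    have "s' t \<ge> 0"
      using b by (simp add: s'_def)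
    then show "norm (of_real (s' t) * (P ?w + of_real b * ?w * deriv P ?w - 1))
        \<le> s' t * (exp (t * ?r) - 1)"
      using bound[OF in_disc[of t]] t by (simp add: norm_mult mult_left_mono)
  qed simp
  moreover have "u 0 = 0" "v 0 = 0" "u 1 = P z - 1" "v 1 = q_series b ?r - 1"
    by (simp_all add: u_def v_def s_def)
  ultimately show ?thesis
    by simp
qed

section \<open>The logarithmic quotient as a solution\<close>

text \<open>The normalization \<open>f'(0) = 1\<close> keeps \<open>f\<close> and \<open>f'\<close> from vanishing identically, so their zeros are
isolated. Near every point, all quotients are therefore genuine on a punctured neighbourhood.\<close>

lemma class_A_eventually_nonzero:
  assumes f: "f \<in> class_A" and a: "a \<in> unit_disc"
  shows "\<forall>\<^sub>F w in at a. f w \<noteq> 0 \<and> deriv f w \<noteq> 0 \<and> w \<noteq> 0 \<and> w \<in> unit_disc"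
proof -
  have hol: "f holomorphic_on unit_disc" and d0: "deriv f 0 = 1"
    using f by (auto simp: class_A_def)
  obtain c where c: "c \<in> unit_disc" "f c \<noteq> 0"
  proof (rule ccontr)
    assume "\<not> thesis"
    then have "\<forall>w\<in>unit_disc. f w = 0"
      using that by blast
    then have "\<forall>\<^sub>F w in nhds 0. f w = 0"
      by (intro eventually_nhds[THEN iffD2] exI[of _ unit_disc]) auto
    then have "deriv f 0 = deriv (\<lambda>_. 0) 0"
      by (rule deriv_cong_ev) simp
    with d0 show False
      by simp
  qed
  have "\<forall>\<^sub>F w in at a. f w \<noteq> 0 \<and> w \<in> unit_disc"
    by (rule non_zero_neighbour_alt[OF hol _ _ a c]) auto
  moreover have "\<forall>\<^sub>F w in at a. deriv f w \<noteq> 0 \<and> w \<in> unit_disc"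
    using hol d0
    by (intro non_zero_neighbour_alt[of _ _ a 0] a holomorphic_intros) auto
  moreover have "\<forall>\<^sub>F w in at a. (w::complex) \<noteq> 0 \<and> w \<in> unit_disc"
    by (rule non_zero_neighbour_alt[where \<beta> = "1/2", OF _ _ _ a]) auto
  ultimately show ?thesis
    by eventually_elim auto
qed

text \<open>This is the identity \<open>z P' = P \<G>\<close>, which makes the differential expression linear in \<open>P\<close>.\<close>

lemma calG_log_quot:
  assumes hol: "f holomorphic_on unit_disc" and w: "w \<in> unit_disc"
    and nz: "f w \<noteq> 0" "deriv f w \<noteq> 0"
  shows "(1 + b * calG f w) * (w * deriv f w / f w) = log_quot f w + b * w * deriv (log_quot f) w"
proof -
  have 1: "(f has_field_derivative deriv f w) (at w)"
    using hol w by (intro holomorphic_derivI) auto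
  have 2: "(deriv f has_field_derivative deriv (deriv f) w) (at w)"
    using hol w by (intro holomorphic_derivI[of _ unit_disc] holomorphic_intros) auto
  have "(log_quot f has_field_derivative
      ((deriv f w + w * deriv (deriv f) w) * f w - w * deriv f w * deriv f w) / (f w * f w)) (at w)"
    unfolding log_quot_def[abs_def] using nz
    by (auto intro!: derivative_eq_intros 1 2)
  note D = DERIV_imp_deriv[OF this]
  have "w * deriv (log_quot f) w = calG f w * log_quot f w"
    unfolding D calG_def log_quot_def using nz by (simp add: field_simps)
  then show ?thesis
    by (simp add: log_quot_def[symmetric] algebra_simps)
qed

text \<open>Where \<open>f\<close> and \<open>f'\<close> do not vanish, the expression is continuous, so removing singularities leaves its
value as it is.\<close>

lemma remove_sings_calG:
  assumes hol: "f holomorphic_on unit_disc" and w: "w \<in> unit_disc"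
    and nz: "f w \<noteq> 0" "deriv f w \<noteq> 0"
  shows "remove_sings (\<lambda>z. (1 + b * calG f z) * (z * deriv f z / f z)) w
    = log_quot f w + b * w * deriv (log_quot f) w"
proof -
  have cont: "isCont g w" if "g holomorphic_on unit_disc" for g
    using that w holomorphic_on_imp_continuous_on[of g] continuous_on_eq_continuous_at[of unit_disc g]
    by auto
  have "isCont (\<lambda>z. (1 + b * calG f z) * (z * deriv f z / f z)) w"
    unfolding calG_def using nz hol
    by (intro continuous_intros cont holomorphic_intros) auto
  then show ?thesis
    unfolding calG_log_quot[OF assms, symmetric]
    by (intro remove_sings_eqI isContD)
qed

text \<open>At a zero \<open>a\<close> of order \<open>n\<close>, write \<open>f(w) = (w - a)\<^sup>n g(w)\<close>, so that \<open>P(w) = K(w) / (w - a)\<close> with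
\<open>K(a) = n a\<close>. Multiplying \<open>P + b w P' = h\<close> by \<open>(w - a)\<^sup>2\<close> and letting \<open>w\<close> tend to \<open>a\<close> leaves
\<open>- b n a\<^sup>2\<close> on the left. On the right it leaves 0, as \<open>h\<close> is continuous at \<open>a\<close>; this forces \<open>a = 0\<close>.\<close>

lemma class_A_nonzero:
  assumes f: "f \<in> class_A" and b: "b \<noteq> 0" and a: "a \<in> unit_disc" "a \<noteq> 0"
    and cont: "continuous_on unit_disc (remove_sings (\<lambda>z. (1 + b * calG f z) * (z * deriv f z / f z)))"
  shows "f a \<noteq> 0"
proof
  assume fa: "f a = 0"
  let ?h = "remove_sings (\<lambda>z. (1 + b * calG f z) * (z * deriv f z / f z))"
  have hol: "f holomorphic_on unit_disc"
    using f by (auto simp: class_A_def)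
  have nonconst: "\<not> f constant_on unit_disc"
  proof
    assume "f constant_on unit_disc"
    with a fa have "\<forall>w\<in>unit_disc. f w = 0"
      by (metis constant_on_def)
    moreover have "\<exists>w. f w \<noteq> 0 \<and> w \<in> unit_disc"
      using eventually_happens[OF class_A_eventually_nonzero[OF f a(1)]] by auto
    ultimately show False
      by blast
  qed
  obtain g r n where n: "0 < n" and r: "0 < r" "ball a r \<subseteq> unit_disc"
    and g: "g holomorphic_on ball a r" and fg: "\<And>w. w \<in> ball a r \<Longrightarrow> f w = (w - a) ^ n * g w"
    and gnz: "\<And>w. w \<in> ball a r \<Longrightarrow> g w \<noteq> 0"
    by (rule holomorphic_factor_zero_nonconstant[OF hol open_ball connected_ball a(1) fa nonconst])
      (rule that)
  define K where "K w = w * (of_nat n + (w - a) * deriv g w / g w)" for w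
  have K: "K holomorphic_on ball a r"
    unfolding K_def using g gnz by (intro holomorphic_intros) auto
  have lq: "log_quot f w = K w / (w - a)" if w: "w \<in> ball a r - {a}" for w
  proof -
    have "\<forall>\<^sub>F v in nhds w. f v = (v - a) ^ n * g v"
      using w fg by (intro eventually_nhds[THEN iffD2] exI[of _ "ball a r"]) auto
    then have "deriv f w = deriv (\<lambda>v. (v - a) ^ n * g v) w"
      by (rule deriv_cong_ev) simp
    also have "(g has_field_derivative deriv g w) (at w)"
      using g w by (intro holomorphic_derivI[of _ "ball a r"]) auto
    then have "((\<lambda>v. (v - a) ^ n * g v) has_field_derivative
        of_nat n * (w - a) ^ (n - 1) * g w + deriv g w * (w - a) ^ n) (at w)"
      by (auto intro!: derivative_eq_intros)
    then have "deriv (\<lambda>v. (v - a) ^ n * g v) w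
        = of_nat n * (w - a) ^ (n - 1) * g w + deriv g w * (w - a) ^ n"
      by (rule DERIV_imp_deriv)
    finally have df: "deriv f w = of_nat n * (w - a) ^ (n - 1) * g w + deriv g w * (w - a) ^ n" .
    have cancel: "w * (m * e * G + G' * (d * e)) / (d * e * G) = w * (m + d * G' / G) / d"
      if "d \<noteq> 0" "e \<noteq> 0" "G \<noteq> 0" for d e m G G' :: complex
      using that by (simp add: field_simps)
    have pow: "(w - a) ^ n = (w - a) * (w - a) ^ (n - 1)"
      using n by (simp add: power_eq_if)
    have "f w = (w - a) * (w - a) ^ (n - 1) * g w"
      using fg[of w] w pow by simp
    then show ?thesis
      unfolding log_quot_def K_def df pow
      using cancel[of "w - a" "(w - a) ^ (n - 1)" "g w"] gnz[of w] w by simp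
  qed
  have eq: "(w - a) ^ 2 * ?h w = (w - a) * K w + b * w * ((w - a) * deriv K w - K w)"
    if w: "w \<in> ball a r - {a}" "f w \<noteq> 0" "deriv f w \<noteq> 0" for w
  proof -
    have "\<forall>\<^sub>F v in nhds w. log_quot f v = K v / (v - a)"
      using w lq by (intro eventually_nhds[THEN iffD2] exI[of _ "ball a r - {a}"]) auto
    then have "deriv (log_quot f) w = deriv (\<lambda>v. K v / (v - a)) w"
      by (rule deriv_cong_ev) simp
    also have "(K has_field_derivative deriv K w) (at w)"
      using K w by (intro holomorphic_derivI[of _ "ball a r"]) auto
    then have "((\<lambda>v. K v / (v - a)) has_field_derivative
        (deriv K w * (w - a) - K w) / ((w - a) * (w - a))) (at w)"
      using w by (auto intro!: derivative_eq_intros)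
    then have "deriv (\<lambda>v. K v / (v - a)) w = (deriv K w * (w - a) - K w) / ((w - a) * (w - a))"
      by (rule DERIV_imp_deriv)
    finally have h: "?h w = K w / (w - a) + b * w * ((deriv K w * (w - a) - K w) / ((w - a) * (w - a)))"
      using remove_sings_calG[OF hol _ w(2,3)] lq[OF w(1)] w(1) r(2) by auto
    have "d ^ 2 * (k / d + b * w * ((k' * d - k) / (d * d))) = d * k + b * w * (d * k' - k)"
      if "d \<noteq> 0" for d k k' :: complex
      using that by (simp add: field_simps power2_eq_square)
    then show ?thesis
      unfolding h using w(1) by simp
  qed
  have "\<forall>\<^sub>F w in at a. w \<in> ball a r - {a}"
    using r(1) by (intro eventually_at_in_open) auto
  with class_A_eventually_nonzero[OF f a(1)]
  have "\<forall>\<^sub>F w in at a. (w - a) ^ 2 * ?h w = (w - a) * K w + b * w * ((w - a) * deriv K w - K w)"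
    by eventually_elim (use eq in auto)
  moreover have "((\<lambda>w. (w - a) ^ 2 * ?h w) \<longlongrightarrow> (a - a) ^ 2 * ?h a) (at a)"
  proof -
    have "isCont ?h a"
      using cont a by (simp add: continuous_on_eq_continuous_at)
    then show ?thesis
      by (intro tendsto_intros isContD)
  qed
  ultimately have
    "((\<lambda>w. (w - a) * K w + b * w * ((w - a) * deriv K w - K w)) \<longlongrightarrow> (a - a) ^ 2 * ?h a) (at a)"
    by (rule Lim_transform_eventually[rotated])
  moreover have "((\<lambda>w. (w - a) * K w + b * w * ((w - a) * deriv K w - K w))
      \<longlongrightarrow> (a - a) * K a + b * a * ((a - a) * deriv K a - K a)) (at a)"
  proof -
    have "isCont K a" "isCont (deriv K) a"
      using holomorphic_on_imp_continuous_on[OF K] r(1)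
        holomorphic_on_imp_continuous_on[OF holomorphic_deriv[OF K]]
      by (auto simp: continuous_on_eq_continuous_at)
    then show ?thesis
      by (intro tendsto_intros isContD)
  qed
  ultimately have "(a - a) ^ 2 * ?h a = (a - a) * K a + b * a * ((a - a) * deriv K a - K a)"
    by (rule tendsto_unique[OF at_neq_bot])
  then have "b * a * K a = 0"
    by simp
  then show False
    using a b n by (simp add: K_def)
qed

text \<open>Away from 0 there are no zeros, so \<open>f(z) = z F(z)\<close> with \<open>F\<close> free of zeros, and \<open>f' / F\<close> is the analytic
continuation of the logarithmic quotient. Values after removing singularities depend only on
punctured neighbourhoods, where the identities hold literally.\<close>

lemma log_quot_solves_ODE:
  assumes f: "f \<in> class_A" and b: "b \<noteq> 0"
    and cont: "continuous_on unit_disc (remove_sings (\<lambda>z. (1 + b * calG f z) * (z * deriv f z / f z)))"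
  obtains P where "P holomorphic_on unit_disc" "P 0 = 1"
    "\<And>z. z \<in> unit_disc \<Longrightarrow> remove_sings (log_quot f) z = P z"
    "\<And>z. z \<in> unit_disc \<Longrightarrow>
       remove_sings (\<lambda>z. (1 + b * calG f z) * (z * deriv f z / f z)) z = P z + b * z * deriv P z"
proof -
  let ?H = "\<lambda>z. (1 + b * calG f z) * (z * deriv f z / f z)"
  have hol: "f holomorphic_on unit_disc" and f0: "f 0 = 0" and d0: "deriv f 0 = 1"
    using f by (auto simp: class_A_def)
  obtain F where F: "F holomorphic_on unit_disc" and fF: "\<And>z. norm z < 1 \<Longrightarrow> f z = z * F z"
    and F0: "deriv f 0 = F 0"
    using Schwarz3[OF hol f0] by auto
  have Fnz: "F z \<noteq> 0" if "z \<in> unit_disc" for z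
    using class_A_nonzero[OF f b that _ cont] fF[of z] F0 d0 that by (cases "z = 0") auto
  define P where "P z = deriv f z / F z" for z
  have P: "P holomorphic_on unit_disc"
    unfolding P_def using hol F Fnz by (intro holomorphic_intros) auto
  have lq: "log_quot f z = P z" if "z \<in> unit_disc - {0}" for z
    using that fF[of z] by (auto simp: P_def log_quot_def)
  have dlq: "deriv (log_quot f) z = deriv P z" if "z \<in> unit_disc - {0}" for z
    using that lq
    by (intro deriv_cong_ev refl eventually_nhds[THEN iffD2] exI[of _ "unit_disc - {0}"]) auto
  have ev: "\<forall>\<^sub>F w in at z. log_quot f w = P w \<and> ?H w = P w + b * w * deriv P w"
    if "z \<in> unit_disc" for z
    using class_A_eventually_nonzero[OF f that]
    by eventually_elim (use lq dlq calG_log_quot[OF hol] in auto)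
  have an: "g analytic_on {z}" if "g holomorphic_on unit_disc" "z \<in> unit_disc" for g z
    using that by (auto simp: analytic_at intro!: exI[of _ unit_disc])
  show ?thesis
  proof
    show "P holomorphic_on unit_disc" by (rule P)
    show "P 0 = 1"
      using F0 d0 by (simp add: P_def)
    fix z :: complex assume z: "z \<in> unit_disc"
    have "remove_sings (log_quot f) z = remove_sings P z"
      by (rule remove_sings_cong[OF eventually_mono[OF ev[OF z]]]) auto
    then show "remove_sings (log_quot f) z = P z"
      using an[OF P z] by simp
    have "remove_sings ?H z = remove_sings (\<lambda>w. P w + b * w * deriv P w) z"
      by (rule remove_sings_cong[OF eventually_mono[OF ev[OF z]]]) auto
    also have "\<dots> = P z + b * z * deriv P z"
      using P by (intro remove_sings_at_analytic an[OF _ z] holomorphic_intros) auto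
    finally show "remove_sings ?H z = P z + b * z * deriv P z" .
  qed
qed

section \<open>The image of the nephroid map\<close>

text \<open>The difference quotient of \<open>z - z\<^sup>3/3\<close> is \<open>1 - (z\<^sup>2 + z w + w\<^sup>2)/3\<close>, which cannot vanish when
\<open>\<bar>z\<bar>\<close> and \<open>\<bar>w\<bar>\<close> are less than 1.\<close>

lemma univalent_phi_Ne: "univalent phi_Ne"
  unfolding univalent_def
proof
  show "phi_Ne holomorphic_on unit_disc"
    unfolding phi_Ne_def[abs_def] by (intro holomorphic_intros) auto
  show "inj_on phi_Ne unit_disc"
  proof (rule inj_onI)
    fix z w assume zw: "z \<in> unit_disc" "w \<in> unit_disc" "phi_Ne z = phi_Ne w"
    have "(z - w) * (3 - (z * z + z * w + w * w)) = 3 * (phi_Ne z - phi_Ne w)"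
      by (simp add: phi_Ne_def algebra_simps power3_eq_cube)
    then have "(z - w) * (3 - (z * z + z * w + w * w)) = 0"
      using zw by simp
    moreover have "norm (z * z + z * w + w * w) < 3"
    proof -
      have "norm z < 1" "norm w < 1"
        using zw by auto
      then have "norm (z * z) < 1" "norm (z * w) < 1" "norm (w * w) < 1"
        using mult_strict_mono'[of "norm z" 1 "norm z" 1] mult_strict_mono'[of "norm z" 1 "norm w" 1]
          mult_strict_mono'[of "norm w" 1 "norm w" 1] by (auto simp: norm_mult)
      then show ?thesis
        using norm_triangle_ineq[of "z * z + z * w" "w * w"] norm_triangle_ineq[of "z * z" "z * w"]
        by linarith
    qed
    then have "3 - (z * z + z * w + w * w) \<noteq> 0"
      by auto
    ultimately show "z = w"
      by simp
  qed
qed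

text \<open>Solving \<open>phi_Ne z = c\<close> means finding a fixed point of \<open>z \<mapsto> (c - 1) + z\<^sup>3/3\<close>. For
\<open>\<bar>c - 1\<bar> < 2/3\<close> this maps the closed unit disc into the open one, so Brouwer's theorem gives a fixed
point, and it lies in the open disc.\<close>

lemma ball_subset_phi_Ne_image: "ball 1 (2/3) \<subseteq> phi_Ne ` unit_disc"
proof
  fix c :: complex assume "c \<in> ball 1 (2/3)"
  then have c: "norm (c - 1) < 2/3"
    by (simp add: dist_norm norm_minus_commute)
  let ?T = "\<lambda>z. (c - 1) + z ^ 3 / 3"
  have T: "norm (?T z) < 1" if "z \<in> cball 0 1" for z
  proof -
    have "norm (z ^ 3 / 3) \<le> 1/3"
      using that power_le_one[of "norm z" 3] by (simp add: norm_divide norm_power)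
    then show ?thesis
      using norm_triangle_ineq[of "c - 1" "z ^ 3 / 3"] c by linarith
  qed
  obtain z where z: "z \<in> cball 0 1" "?T z = z"
  proof (rule brouwer[of "cball 0 1" ?T])
    show "continuous_on (cball 0 1) ?T"
      by (intro continuous_intros) auto
    show "?T \<in> cball 0 1 \<rightarrow> cball 0 1"
      using T by (auto simp: less_imp_le)
  qed auto
  have "z \<in> unit_disc"
    using T[OF z(1)] z(2) by simp
  moreover have "phi_Ne z = c"
    using z(2) by (simp add: phi_Ne_def algebra_simps)
  ultimately show "c \<in> phi_Ne ` unit_disc"
    by blast
qed

section \<open>The subordination theorem\<close>

text \<open>Here the estimates meet: \<open>\<bar>P(z) - 1\<bar> \<le> \<bar>z\<bar> (q(1) - 1) < 2/3\<close> for \<open>z \<noteq> 0\<close>, which puts the values of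
\<open>P\<close> into the disc covered by \<^const>\<open>phi_Ne\<close>.\<close>

lemma S_star_Ne_if_q_series_1_le:
  assumes f: "f \<in> class_A" and b: "b > 0" and q1: "q_series b 1 \<le> 5 / 3"
    and sub: "remove_sings (\<lambda>z. (1 + complex_of_real b * calG f z) * (z * deriv f z / f z)) \<prec>\<^sub>s exp"
      (is "?h \<prec>\<^sub>s exp")
  shows "f \<in> S_star_Ne"
proof -
  have cont: "continuous_on unit_disc ?h"
    using sub unfolding subordinate_def by (blast intro: holomorphic_on_imp_continuous_on)
  have b_nz: "complex_of_real b \<noteq> 0"
    using b by simp
  obtain P where P: "P holomorphic_on unit_disc" "P 0 = 1"
    and lq: "\<And>z. z \<in> unit_disc \<Longrightarrow> remove_sings (log_quot f) z = P z"
    and ode: "\<And>z. z \<in> unit_disc \<Longrightarrow> ?h z = P z + of_real b * z * deriv P z"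
    by (rule log_quot_solves_ODE[OF f b_nz cont]) (rule that)
  have "P z \<in> ball 1 (2/3)" if z: "z \<in> unit_disc" for z
  proof (cases "z = 0")
    case False
    have "norm (P w + of_real b * w * deriv P w - 1) \<le> exp (norm w) - 1" if "w \<in> unit_disc" for w
      using subordinate_exp_bound[OF sub that] unfolding ode[OF that] .
    then have "norm (P z - 1) \<le> q_series b (norm z) - 1"
      by (rule norm_minus_1_le_q_series[OF P(1) b _ z])
    also have "\<dots> \<le> norm z * (q_series b 1 - 1)"
      using b z by (intro q_series_le_chord) auto
    also have "\<dots> \<le> norm z * (2/3)"
      using q1 by (intro mult_left_mono) auto
    also have "\<dots> < 2/3"
      using z by simp
    finally show ?thesis
      by (simp add: dist_norm norm_minus_commute)
  qed (simp add: P)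
  then have "P ` unit_disc \<subseteq> phi_Ne ` unit_disc"
    using ball_subset_phi_Ne_image by blast
  moreover have "remove_sings (log_quot f) holomorphic_on unit_disc"
    by (rule holomorphic_transform[OF P(1) lq[symmetric]])
  moreover have "remove_sings (log_quot f) ` unit_disc = P ` unit_disc"
    using lq by (intro image_cong) auto
  ultimately have "remove_sings (log_quot f) \<prec>\<^sub>s phi_Ne"
    unfolding subordinate_def using univalent_phi_Ne lq[of 0] P(2) phi_Ne_def[of 0] by simp
  then show ?thesis
    using f by (simp add: S_star_Ne_def)
qed

theorem corollary3p3:
  shows "\<exists>\<beta>\<^sub>e::real.
    \<beta>\<^sub>e > 0 \<and> (\<Sum>j. 1 / (fact j * (1 + real j * \<beta>\<^sub>e))) - 5 / 3 = 0 \<and>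
    (\<forall>b::real. b > 0 \<and> (\<Sum>j. 1 / (fact j * (1 + real j * b))) - 5 / 3 = 0 \<longrightarrow> b = \<beta>\<^sub>e) \<and>
    \<bar>\<beta>\<^sub>e - 1.14016\<bar> < 0.002 \<and>
    (\<forall>f \<in> class_A. \<forall>\<beta>::real. \<beta> \<ge> \<beta>\<^sub>e \<longrightarrow>
       remove_sings (\<lambda>z. (1 + complex_of_real \<beta> * calG f z) * (z * deriv f z / f z)) \<prec>\<^sub>s exp \<longrightarrow>
       f \<in> S_star_Ne)"
proof -
  obtain be where be: "be > 0" "\<bar>be - 1.14016\<bar> < 0.002" "q_series be 1 = 5 / 3"
    by (rule q_series_1_eq_five_thirds)
  have unique: "b = be" if "b > 0" "q_series b 1 = 5 / 3" for b
    using q_series_1_strict_antimono[of b be] q_series_1_strict_antimono[of be b] that be(1,3)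
    by (cases b be rule: linorder_cases) auto
  have star: "f \<in> S_star_Ne"
    if "f \<in> class_A" "\<beta> \<ge> be"
      "remove_sings (\<lambda>z. (1 + complex_of_real \<beta> * calG f z) * (z * deriv f z / f z)) \<prec>\<^sub>s exp"
    for f \<beta>
  proof -
    have "\<beta> > 0"
      using be(1) that(2) by linarith
    moreover have "q_series \<beta> 1 \<le> 5 / 3"
      using q_series_1_strict_antimono[of be \<beta>] be(1,3) that(2) by (cases "\<beta> = be") auto
    ultimately show ?thesis
      using that(3) by (rule S_star_Ne_if_q_series_1_le[OF that(1)])
  qed
  show ?thesis
    unfolding q_series_1[symmetric]
  proof (intro exI[of _ be] conjI allI impI ballI)
    show "b = be" if "0 < b \<and> q_series b 1 - 5 / 3 = 0" for b
      using unique[of b] that by simp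
    show "q_series be 1 - 5 / 3 = 0"
      using be(3) by simp
  qed (fact be star)+
qed

end
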